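(* Let $S$ be a $\mathcal C$-semigroup and $m,f\in\mathcal C$ with $m\notin\Lambda$. Then $S\in\mathcal A(f)$ with $\operatorname{rank}_{\mathcal A(f)}(S)=1$ if and only if $$S=\langle m\rangle\cup\Delta(f),$$ where $m\prec f$ and $f\notin\langle m\rangle$.
   Context: Notation: $\mathbb N=\{0,1,2,\dots\}$, $p\ge 1$, and $\Lambda=\{e_1,\dots,e_p\}$ is the canonical basis of $\mathbb N^p$; $\langle m\rangle=\{\lambda m\mid\lambda\in\mathbb N\}$. $\mathcal C\subseteq\mathbb N^p$ is a fixed non-negative integer cone (the set of points of $\mathbb N^p$ lying in a finitely generated rational convex cone), with at least $p$ extremal rays. A $\mathcal C$-semigroup is an infinite, finitely generated submonoid $S\subseteq\mathcal C$ of $\mathbb N^p$ such that the minimal integer cone containing $S$ is $\mathcal C$ and $\mathcal H(S)=\mathcal C\setminus S$ is finite. A monomial order $\preceq$ on $\mathbb N^p$ is fixed: a total order compatible with addition with $0\preceq x$ for all $x$; it is assumed that $\{x\in\mathcal C\mid x\preceq k\}$ is finite for every $k\in\mathcal C$. $\operatorname{Fb}(S)=\max_\preceq\mathcal H(S)$ (and $-\sum_i e_i$ if $\mathcal H(S)=\emptyset$), $\operatorname{N}(S)=\{x\in S\mid x\prec\operatorname{Fb}(S)\}$. A $\mathcal C$-semigroup $S$ is an $\mathcal A$-semigroup if for every $s\in S$ and $e\in\Lambda$ the set $\{s,s+e\}$ is not contained in $\operatorname{N}(S)$. For $f\in\mathcal C\setminus\{0\}$, $\mathcal A(f)$ is the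 set of all $\mathcal A$-semigroups $S$ with $\operatorname{Fb}(S)=f$, and $\Delta(f)=\{0\}\cup\{x\in\mathcal C\mid x\succ f\}$. A set $X$ is an $\mathcal A(f)$-set if $X\cap\Delta(f)=\emptyset$ and there is $S\in\mathcal A(f)$ with $X\subset S$. For an $\mathcal A(f)$-set $X$, $\mathcal A(f)[X]$ is the intersection of all elements of $\mathcal A(f)$ containing $X$. $X$ is an $\mathcal A(f)$-system of generators of $S$ if $X$ is an $\mathcal A(f)$-set and $S=\mathcal A(f)[X]$; it is minimal if no proper subset $Y\subsetneq X$ satisfies $\mathcal A(f)[Y]=S$. Every $S\in\mathcal A(f)$ has a unique minimal $\mathcal A(f)$-system of generators; its cardinality is $\operatorname{rank}_{\mathcal A(f)}(S)$.
   Formalization: The element m is read as existentially quantified on the right-hand side (for a fixed m the "only if" fails), and m ≠ 0 is required, since m = 0 gives S = Δ(f), which has rank 0 and not 1. *)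

theory Defs
  imports "HOL-Analysis.Analysis"
begin

text \<open>The monoid of \<open>p\<close>-tuples of naturals is the type \<open>nat ^ 'p\<close>, with \<open>p = CARD('p) \<ge> 1\<close>.
  The cone \<open>C\<close> and the monomial order \<open>le\<close> are explicit parameters.\<close>

definition canonical_basis :: "(nat ^ 'p) set" where
  "canonical_basis = range (\<lambda>i. axis i 1)"

definition multiples :: "nat ^ 'p \<Rightarrow> (nat ^ 'p) set" where
  "multiples m = {k *s m | k. True}"

definition real_vec :: "nat ^ 'p \<Rightarrow> real ^ 'p" where
  "real_vec x = (\<chi> i. real (x $ i))"

definition int_vec :: "nat ^ 'p \<Rightarrow> int ^ 'p" where
  "int_vec x = (\<chi> i. int (x $ i))"

definition integer_cone :: "(nat ^ 'p) set \<Rightarrow> bool" where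
  "integer_cone C \<longleftrightarrow>
     (\<exists>G :: (real ^ 'p) set. finite G \<and> (\<forall>g\<in>G. \<forall>i. g $ i \<in> \<rat>) \<and>
        C = {x. real_vec x \<in> convex_cone hull G})"

text \<open>The real cone spanned by \<open>C\<close> lies in the non-negative orthant and so contains no line; hence
  its extremal rays are exactly its one-dimensional faces.\<close>

definition extremal_rays :: "(nat ^ 'p) set \<Rightarrow> (real ^ 'p) set set" where
  "extremal_rays C = {R. R face_of (convex_cone hull (real_vec ` C)) \<and> aff_dim R = 1}"

definition minimal_integer_cone :: "(nat ^ 'p) set \<Rightarrow> (nat ^ 'p) set \<Rightarrow> bool" where
  "minimal_integer_cone S C \<longleftrightarrow>
     integer_cone C \<and> S \<subseteq> C \<and> (\<forall>D. integer_cone D \<and> S \<subseteq> D \<longrightarrow> C \<subseteq> D)"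

definition submonoid :: "(nat ^ 'p) set \<Rightarrow> bool" where
  "submonoid S \<longleftrightarrow> 0 \<in> S \<and> (\<forall>x\<in>S. \<forall>y\<in>S. x + y \<in> S)"

definition finitely_generated :: "(nat ^ 'p) set \<Rightarrow> bool" where
  "finitely_generated S \<longleftrightarrow> (\<exists>A. finite A \<and> S = submonoid hull A)"

definition gaps :: "(nat ^ 'p) set \<Rightarrow> (nat ^ 'p) set \<Rightarrow> (nat ^ 'p) set" where
  "gaps C S = C - S"

definition C_semigroup :: "(nat ^ 'p) set \<Rightarrow> (nat ^ 'p) set \<Rightarrow> bool" where
  "C_semigroup C S \<longleftrightarrow>
     infinite S \<and> submonoid S \<and> finitely_generated S \<and> S \<subseteq> C \<and>
     minimal_integer_cone S C \<and> finite (gaps C S)"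

definition monomial_order :: "(nat ^ 'p \<Rightarrow> nat ^ 'p \<Rightarrow> bool) \<Rightarrow> bool" where
  "monomial_order le \<longleftrightarrow>
     reflp le \<and> transp le \<and> antisymp le \<and> totalp le \<and>
     (\<forall>x y z. le x y \<longrightarrow> le (x + z) (y + z)) \<and> (\<forall>x. le 0 x)"

definition strict :: "(nat ^ 'p \<Rightarrow> nat ^ 'p \<Rightarrow> bool) \<Rightarrow> nat ^ 'p \<Rightarrow> nat ^ 'p \<Rightarrow> bool" where
  "strict le x y \<longleftrightarrow> le x y \<and> x \<noteq> y"

text \<open>A Frobenius element may have negative entries, so it is an integer vector. To compare it with
  elements of a semigroup we use the unique translation-invariant extension of the monomial order
  to integer vectors.\<close>

definition int_strict :: "(nat ^ 'p \<Rightarrow> nat ^ 'p \<Rightarrow> bool) \<Rightarrow> int ^ 'p \<Rightarrow> int ^ 'p \<Rightarrow> bool" where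
  "int_strict le u v \<longleftrightarrow> (\<exists>a b. int_vec b - int_vec a = v - u \<and> strict le a b)"

definition Fb :: "(nat ^ 'p) set \<Rightarrow> (nat ^ 'p \<Rightarrow> nat ^ 'p \<Rightarrow> bool) \<Rightarrow> (nat ^ 'p) set \<Rightarrow> int ^ 'p" where
  "Fb C le S =
     (if gaps C S = {} then - (\<Sum>e\<in>canonical_basis. int_vec e)
      else int_vec (THE h. h \<in> gaps C S \<and> (\<forall>x\<in>gaps C S. le x h)))"

definition small_elements ::
    "(nat ^ 'p) set \<Rightarrow> (nat ^ 'p \<Rightarrow> nat ^ 'p \<Rightarrow> bool) \<Rightarrow> (nat ^ 'p) set \<Rightarrow> (nat ^ 'p) set" where
  "small_elements C le S = {x \<in> S. int_strict le (int_vec x) (Fb C le S)}"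

definition A_semigroup ::
    "(nat ^ 'p) set \<Rightarrow> (nat ^ 'p \<Rightarrow> nat ^ 'p \<Rightarrow> bool) \<Rightarrow> (nat ^ 'p) set \<Rightarrow> bool" where
  "A_semigroup C le S \<longleftrightarrow>
     C_semigroup C S \<and> (\<forall>s\<in>S. \<forall>e\<in>canonical_basis. \<not> {s, s + e} \<subseteq> small_elements C le S)"

text \<open>The next family is of interest for nonzero \<open>f\<close> in \<open>C\<close>; for \<open>f = 0\<close> it is empty,
  since \<open>0\<close> is never a gap.\<close>

definition A_family ::
    "(nat ^ 'p) set \<Rightarrow> (nat ^ 'p \<Rightarrow> nat ^ 'p \<Rightarrow> bool) \<Rightarrow> nat ^ 'p \<Rightarrow> (nat ^ 'p) set set" where
  "A_family C le f = {S. A_semigroup C le S \<and> Fb C le S = int_vec f}"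

definition Delta ::
    "(nat ^ 'p) set \<Rightarrow> (nat ^ 'p \<Rightarrow> nat ^ 'p \<Rightarrow> bool) \<Rightarrow> nat ^ 'p \<Rightarrow> (nat ^ 'p) set" where
  "Delta C le f = {0} \<union> {x \<in> C. strict le f x}"

definition A_set ::
    "(nat ^ 'p) set \<Rightarrow> (nat ^ 'p \<Rightarrow> nat ^ 'p \<Rightarrow> bool) \<Rightarrow> nat ^ 'p \<Rightarrow> (nat ^ 'p) set \<Rightarrow> bool" where
  "A_set C le f X \<longleftrightarrow> X \<inter> Delta C le f = {} \<and> (\<exists>S\<in>A_family C le f. X \<subseteq> S)"

definition A_closure ::
    "(nat ^ 'p) set \<Rightarrow> (nat ^ 'p \<Rightarrow> nat ^ 'p \<Rightarrow> bool) \<Rightarrow> nat ^ 'p \<Rightarrow> (nat ^ 'p) set \<Rightarrow> (nat ^ 'p) set"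
  where
  "A_closure C le f X = \<Inter> {S \<in> A_family C le f. X \<subseteq> S}"

definition A_generators ::
    "(nat ^ 'p) set \<Rightarrow> (nat ^ 'p \<Rightarrow> nat ^ 'p \<Rightarrow> bool) \<Rightarrow> nat ^ 'p \<Rightarrow>
     (nat ^ 'p) set \<Rightarrow> (nat ^ 'p) set \<Rightarrow> bool" where
  "A_generators C le f S X \<longleftrightarrow> A_set C le f X \<and> S = A_closure C le f X"

definition minimal_A_generators ::
    "(nat ^ 'p) set \<Rightarrow> (nat ^ 'p \<Rightarrow> nat ^ 'p \<Rightarrow> bool) \<Rightarrow> nat ^ 'p \<Rightarrow>
     (nat ^ 'p) set \<Rightarrow> (nat ^ 'p) set \<Rightarrow> bool" where
  "minimal_A_generators C le f S X \<longleftrightarrow>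
     A_generators C le f S X \<and> (\<forall>Y. Y \<subset> X \<longrightarrow> A_closure C le f Y \<noteq> S)"

text \<open>Every member of the family has exactly one minimal system of generators, and that system is
  finite; the value below is meaningful only for members of the family.\<close>

definition A_rank ::
    "(nat ^ 'p) set \<Rightarrow> (nat ^ 'p \<Rightarrow> nat ^ 'p \<Rightarrow> bool) \<Rightarrow> nat ^ 'p \<Rightarrow> (nat ^ 'p) set \<Rightarrow> nat" where
  "A_rank C le f S = card (THE X. minimal_A_generators C le f S X)"

end

theory Submission
  imports Defs
begin

text \<open>
  Let \<open>S\<close> belong to \<open>A(f)\<close>. Membership of a submonoid in \<open>A(f)\<close> says that it contains \<open>\<Delta>(f)\<close>,
  avoids \<open>f\<close>, and has no two elements \<open>s\<close> and \<open>s + e\<close> below \<open>f\<close> with \<open>e\<close> a basis vector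
  (\<open>A_family_iff\<close>). The last two conditions are inherited by subsets, so every submonoid between
  \<open>\<Delta>(f)\<close> and \<open>S\<close> is again in \<open>A(f)\<close>. Hence the least element of \<open>A(f)\<close> containing
  \<open>X \<subseteq> S\<close> is simply the monoid generated by \<open>X \<union> \<Delta>(f)\<close> (\<open>A_closure_eq_hull\<close>).

  A submonoid of \<open>\<nat>\<^sup>p\<close> is generated by exactly those subsets of it that contain all its
  irreducible elements. Therefore the only minimal \<open>A(f)\<close>-system of generators of \<open>S\<close> is the set of
  irreducibles of \<open>S\<close> outside \<open>\<Delta>(f)\<close>, and the rank is its cardinality (\<open>A_rank_eq\<close>). Rank one with
  irreducible \<open>m\<close> means that \<open>S\<close> is generated by \<open>m\<close> and \<open>\<Delta>(f)\<close>; since \<open>\<Delta>(f) - {0}\<close> absorbs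
  addition of cone elements, this monoid is \<open>\<langle>m\<rangle> \<union> \<Delta>(f)\<close>. A basis vector \<open>m\<close> is excluded by the pair
  \<open>0, m\<close>. Conversely, if \<open>k m + e = l m\<close>, then \<open>m\<close> divides the basis vector \<open>e\<close>, so \<open>m = e\<close>; thus
  \<open>m \<notin> \<Lambda>\<close> suffices for membership in \<open>A(f)\<close>.

  The characterisation of \<open>A(f)\<close> rests on the fact that being a \<open>\<C>\<close>-semigroup passes to all submonoids
  with finite complement in the cone. Finite generation is the substantial part
  (\<open>cofinite_submonoid_finitely_generated\<close>): an element with a large coordinate sum is a sum of two
  smaller elements that are both too large to be gaps.
\<close>

section \<open>Submonoids of the natural lattice\<close>

definition coord_sum :: "nat ^ 'p \<Rightarrow> nat" where
  "coord_sum x = (\<Sum>i\<in>UNIV. x $ i)"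

lemma coord_sum_add: "coord_sum (x + y) = coord_sum x + coord_sum y"
  by (simp add: coord_sum_def sum.distrib)

lemma coord_sum_zero: "coord_sum 0 = 0"
  by (simp add: coord_sum_def)

lemma coord_sum_eq_0_iff: "coord_sum x = 0 \<longleftrightarrow> x = 0"
  by (simp add: coord_sum_def vec_eq_iff)

lemma finite_coord_sum_le: "finite {x :: nat ^ 'p. coord_sum x \<le> n}"
proof (rule finite_subset)
  have "x $ i \<le> coord_sum x" for x :: "nat ^ 'p" and i
    unfolding coord_sum_def by (rule member_le_sum) auto
  then have "x \<in> vec_lambda ` (UNIV \<rightarrow>\<^sub>E {..n})" if "coord_sum x \<le> n" for x :: "nat ^ 'p"
    using that by (intro image_eqI[where x = "vec_nth x"]) (auto intro: order_trans)
  then show "{x :: nat ^ 'p. coord_sum x \<le> n} \<subseteq> vec_lambda ` (UNIV \<rightarrow>\<^sub>E {..n})"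
    by blast
  show "finite (vec_lambda ` ((UNIV :: 'p set) \<rightarrow>\<^sub>E {..n}))"
    by (intro finite_imageI finite_PiE) auto
qed

lemma finite_imp_coord_sum_bounded:
  fixes A :: "(nat ^ 'p) set"
  assumes "finite A"
  shows "\<exists>n. \<forall>x\<in>A. coord_sum x \<le> n"
  using finite_nat_set_iff_bounded_le[of "coord_sum ` A"] assms by auto

lemma submonoid_zero: "submonoid S \<Longrightarrow> 0 \<in> S"
  by (simp add: submonoid_def)

lemma submonoid_add: "submonoid S \<Longrightarrow> x \<in> S \<Longrightarrow> y \<in> S \<Longrightarrow> x + y \<in> S"
  by (simp add: submonoid_def)

lemma submonoid_hull: "submonoid (submonoid hull X)"
  by (rule hull_in) (auto simp: submonoid_def)

lemma submonoid_multiples: "submonoid (multiples m)"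
proof -
  have "0 = 0 *s m" and "\<And>a b. a *s m + b *s m = (a + b) *s m"
    by (simp_all add: vec_eq_iff distrib_right)
  then show ?thesis
    unfolding submonoid_def multiples_def by blast
qed

lemma multiples_subset:
  assumes "submonoid S" "m \<in> S"
  shows "multiples m \<subseteq> S"
proof -
  have "k *s m \<in> S" for k
  proof (induction k)
    case 0
    have "0 *s m = 0" by (simp add: vec_eq_iff)
    then show ?case using submonoid_zero[OF assms(1)] by simp
  next
    case (Suc k)
    have "Suc k *s m = m + k *s m" by (simp add: vec_eq_iff)
    then show ?case using submonoid_add[OF assms(1,2) Suc] by simp
  qed
  then show ?thesis by (auto simp: multiples_def)
qed

lemma self_in_multiples: "m \<in> multiples m"
proof -
  have "m = 1 *s m" by (simp add: vec_eq_iff)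
  then show ?thesis unfolding multiples_def by blast
qed

lemma sum_in_multiples_cancel:
  assumes "x + y \<in> multiples m" "x \<in> multiples m"
  shows "y \<in> multiples m"
proof -
  obtain a b where ab: "x + y = a *s m" "x = b *s m"
    using assms by (auto simp: multiples_def)
  have "y = (a - b) *s m"
    unfolding vec_eq_iff
  proof
    fix i
    have "b * m $ i + y $ i = a * m $ i"
      using ab by (metis vector_add_component vector_smult_component)
    then have "y $ i = a * m $ i - b * m $ i" by simp
    then show "y $ i = ((a - b) *s m) $ i"
      by (simp add: diff_mult_distrib)
  qed
  then show ?thesis by (auto simp: multiples_def)
qed

lemma basis_vector_in_multiples:
  assumes "e \<in> canonical_basis" "e \<in> multiples m"
  shows "m = e"
proof -
  obtain i k where e: "e = axis i 1" "axis i 1 = k *s m"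
    using assms by (auto simp: canonical_basis_def multiples_def)
  have "k * m $ i = 1"
    using arg_cong[OF e(2), of "\<lambda>v. v $ i"] by simp
  then have "k = 1" by simp
  then show ?thesis using e by (simp add: vec_eq_iff)
qed

section \<open>Irreducible elements and generating sets\<close>

definition irreducibles :: "(nat ^ 'p) set \<Rightarrow> (nat ^ 'p) set" where
  "irreducibles S = {x \<in> S - {0}. \<forall>y\<in>S - {0}. \<forall>z\<in>S - {0}. x \<noteq> y + z}"

text \<open>Splitting a reducible element lowers the coordinate sum, so the splitting terminates.\<close>

lemma submonoid_hull_irreducibles:
  assumes "submonoid S"
  shows "submonoid hull (irreducibles S) = S"
proof (rule antisym)
  show "submonoid hull (irreducibles S) \<subseteq> S"
    using assms by (intro hull_minimal) (auto simp: irreducibles_def)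
  have "x \<in> submonoid hull (irreducibles S)" if "x \<in> S" for x
    using that
  proof (induction x rule: measure_induct_rule[of coord_sum])
    case (less x)
    show ?case
    proof (cases "x = 0 \<or> x \<in> irreducibles S")
      case True
      then show ?thesis
        using submonoid_zero[OF submonoid_hull] hull_inc by metis
    next
      case False
      then obtain y z where yz: "y \<in> S" "z \<in> S" "y \<noteq> 0" "z \<noteq> 0" "x = y + z"
        using less.prems by (auto simp: irreducibles_def)
      then have "coord_sum y < coord_sum x" "coord_sum z < coord_sum x"
        using coord_sum_eq_0_iff[of y] coord_sum_eq_0_iff[of z] by (auto simp: coord_sum_add)
      then show ?thesis
        using less.IH yz submonoid_add[OF submonoid_hull] by metis
    qed
  qed
  then show "S \<subseteq> submonoid hull (irreducibles S)" by blast
qed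

text \<open>Removing an irreducible element from a submonoid leaves a submonoid, so no generating set can
  omit it.\<close>

lemma submonoid_hull_eq_iff:
  assumes S: "submonoid S" and "Y \<subseteq> S"
  shows "submonoid hull Y = S \<longleftrightarrow> irreducibles S \<subseteq> Y"
proof
  assume Y: "submonoid hull Y = S"
  show "irreducibles S \<subseteq> Y"
  proof (rule subsetI, rule ccontr)
    fix x assume x: "x \<in> irreducibles S" and "x \<notin> Y"
    have "submonoid (S - {x})"
      unfolding submonoid_def
    proof (intro conjI ballI)
      show "0 \<in> S - {x}"
        using x submonoid_zero[OF S] by (auto simp: irreducibles_def)
      fix y z assume yz: "y \<in> S - {x}" "z \<in> S - {x}"
      have "y + z \<noteq> x"
      proof (cases "y = 0 \<or> z = 0")
        case True
        then show ?thesis using yz by auto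
      next
        case False
        then show ?thesis using x yz by (auto simp: irreducibles_def)
      qed
      then show "y + z \<in> S - {x}"
        using yz submonoid_add[OF S] by auto
    qed
    then have "submonoid hull Y \<subseteq> S - {x}"
      using \<open>Y \<subseteq> S\<close> \<open>x \<notin> Y\<close> by (intro hull_minimal) auto
    then show False
      using Y x by (auto simp: irreducibles_def)
  qed
next
  assume "irreducibles S \<subseteq> Y"
  then have "S \<subseteq> submonoid hull Y"
    using hull_mono submonoid_hull_irreducibles[OF S] by metis
  moreover have "submonoid hull Y \<subseteq> S"
    using assms by (intro hull_minimal)
  ultimately show "submonoid hull Y = S" by blast
qed

section \<open>Submonoids with finite complement\<close>

text \<open>By induction over how \<open>x\<close> is built from generators. If a sum exceeds \<open>M\<close> but neither summand
  does, then the sum is at most \<open>2 * M\<close> and can itself serve as \<open>y\<close>, with \<open>z = 0\<close>; otherwise the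
  part split off a large summand is used, and the other summand is added to the rest.\<close>

lemma submonoid_hull_split:
  assumes "x \<in> submonoid hull B" and N: "\<forall>b\<in>B. coord_sum b \<le> N" and "M < coord_sum x"
  shows "\<exists>y\<in>submonoid hull B. \<exists>z\<in>submonoid hull B.
    x = y + z \<and> M < coord_sum y \<and> coord_sum y \<le> 2 * M + N"
proof -
  let ?H = "submonoid hull B"
  define split where "split x \<longleftrightarrow>
    (\<exists>y\<in>?H. \<exists>z\<in>?H. x = y + z \<and> M < coord_sum y \<and> coord_sum y \<le> 2 * M + N)" for x
  have whole: "split x" if "x \<in> ?H" "M < coord_sum x" "coord_sum x \<le> 2 * M + N" for x
    unfolding split_def using that submonoid_zero[OF submonoid_hull, of B]
    by (intro bexI[of _ x] bexI[of _ 0]) auto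
  have split_add: "split (x + y)" if "split x" "y \<in> ?H" for x y
    using that submonoid_add[OF submonoid_hull, of _ B] unfolding split_def
    by (metis add.assoc)
  define P where "P x \<longleftrightarrow> x \<in> ?H \<and> (M < coord_sum x \<longrightarrow> split x)" for x
  have "P x"
    using assms(1)
  proof (rule hull_induct)
    fix b assume "b \<in> B"
    then have "b \<in> ?H" by (rule hull_inc)
    moreover have "coord_sum b \<le> 2 * M + N"
      using N \<open>b \<in> B\<close> trans_le_add2 by blast
    ultimately show "P b"
      using whole by (simp add: P_def)
  next
    show "submonoid {x. P x}"
      unfolding submonoid_def
    proof (intro conjI ballI)
      show "0 \<in> {x. P x}"
        using submonoid_zero[OF submonoid_hull, of B] by (simp add: P_def coord_sum_zero)
      fix x y assume "x \<in> {x. P x}" "y \<in> {x. P x}"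
      then have xy: "x \<in> ?H" "y \<in> ?H"
        and P: "M < coord_sum x \<Longrightarrow> split x" "M < coord_sum y \<Longrightarrow> split y"
        by (auto simp: P_def)
      have "x + y \<in> ?H" using submonoid_add[OF submonoid_hull] xy by blast
      moreover have "split (x + y)" if "M < coord_sum (x + y)"
      proof -
        consider "M < coord_sum x" | "M < coord_sum y"
          | "coord_sum x \<le> M" "coord_sum y \<le> M" by linarith
        then show ?thesis
        proof cases
          case 1
          then show ?thesis using P(1) split_add xy by blast
        next
          case 2
          then show ?thesis using P(2) split_add[of y x] xy by (simp add: add.commute)
        next
          case 3
          then show ?thesis using whole \<open>x + y \<in> ?H\<close> that by (simp add: coord_sum_add)
        qed
      qed
      ultimately show "x + y \<in> {x. P x}" by (simp add: P_def)
    qed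
  qed
  then show ?thesis using assms(3) by (simp add: P_def split_def)
qed

lemma cofinite_submonoid_finitely_generated:
  assumes "finitely_generated C" "submonoid T" "T \<subseteq> C" "finite (C - T)"
  shows "finitely_generated T"
proof -
  obtain B where B: "finite B" "C = submonoid hull B"
    using assms(1) by (auto simp: finitely_generated_def)
  obtain N where N: "\<forall>b\<in>B. coord_sum b \<le> N"
    using finite_imp_coord_sum_bounded[OF B(1)] by blast
  obtain M where M: "\<forall>x\<in>C - T. coord_sum x \<le> M"
    using finite_imp_coord_sum_bounded[OF assms(4)] by blast
  \<comment> \<open>Beyond \<open>3 * M + N\<close>, splitting off a part of size in \<open>(M, 2 * M + N]\<close> leaves a rest above \<open>M\<close>,
    and elements of \<open>C\<close> above \<open>M\<close> are in \<open>T\<close>.\<close>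
  define A where "A = {x \<in> T. coord_sum x \<le> 3 * M + N}"
  have "x \<in> submonoid hull A" if "x \<in> T" for x
    using that
  proof (induction x rule: measure_induct_rule[of coord_sum])
    case (less x)
    show ?case
    proof (cases "coord_sum x \<le> 3 * M + N")
      case True
      then show ?thesis using less.prems hull_inc[of x A] by (simp add: A_def)
    next
      case False
      have "x \<in> submonoid hull B" using less.prems assms(3) B(2) by blast
      then obtain y z where yz: "y \<in> C" "z \<in> C" "x = y + z"
          "M < coord_sum y" "coord_sum y \<le> 2 * M + N"
        using submonoid_hull_split[of x B N M] N False B(2) by auto
      then have "M < coord_sum z" using False by (simp add: coord_sum_add)
      then have "y \<in> T" "z \<in> T"
        using M yz(1,2,4) linorder_not_less by blast+
      moreover have "coord_sum y < coord_sum x" "coord_sum z < coord_sum x"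
        using yz \<open>M < coord_sum z\<close> by (auto simp: coord_sum_add)
      ultimately show ?thesis
        using less.IH submonoid_add[OF submonoid_hull] yz(3) by metis
    qed
  qed
  moreover have "submonoid hull A \<subseteq> T"
    using assms(2) by (intro hull_minimal) (auto simp: A_def)
  moreover have "finite A"
    unfolding A_def by (rule finite_subset[OF _ finite_coord_sum_le[of "3 * M + N"]]) auto
  ultimately show ?thesis
    unfolding finitely_generated_def by blast
qed

lemma finitely_generated_cofinite_extension:
  assumes "finitely_generated S" "submonoid C" "S \<subseteq> C" "finite (C - S)"
  shows "finitely_generated C"
proof -
  obtain A where A: "finite A" "S = submonoid hull A"
    using assms(1) by (auto simp: finitely_generated_def)
  have "submonoid hull (A \<union> (C - S)) \<subseteq> C"
    using assms A hull_subset[of A submonoid] by (intro hull_minimal) auto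
  moreover have "S \<subseteq> submonoid hull (A \<union> (C - S))"
    using A hull_mono[of A "A \<union> (C - S)" submonoid] by auto
  moreover have "C - S \<subseteq> submonoid hull (A \<union> (C - S))"
    using hull_subset[of "A \<union> (C - S)" submonoid] by auto
  ultimately have "C = submonoid hull (A \<union> (C - S))" by blast
  then show ?thesis
    unfolding finitely_generated_def using A(1) assms(4) by blast
qed

section \<open>Integer cones\<close>

lemma integer_cone_submonoid:
  assumes "integer_cone C"
  shows "submonoid C"
proof -
  obtain G :: "(real ^ 'a) set" where C: "C = {x. real_vec x \<in> convex_cone hull G}"
    using assms by (auto simp: integer_cone_def)
  have "real_vec 0 = (0 :: real ^ 'a)"
    by (simp add: real_vec_def vec_eq_iff)
  moreover have "real_vec (x + y) = real_vec x + real_vec y" for x y :: "nat ^ 'a"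
    by (simp add: real_vec_def vec_eq_iff)
  ultimately show ?thesis
    by (auto simp: C submonoid_def convex_cone_hull_contains_0 convex_cone_hull_add)
qed

lemma integer_cone_saturated:
  assumes "integer_cone C" "0 < k" "k *s x \<in> C"
  shows "x \<in> C"
proof -
  obtain G :: "(real ^ 'a) set" where C: "C = {x. real_vec x \<in> convex_cone hull G}"
    using assms(1) by (auto simp: integer_cone_def)
  have "real_vec x = (1 / real k) *\<^sub>R real_vec (k *s x)"
    using assms(2) by (simp add: real_vec_def vec_eq_iff)
  moreover have "(1 / real k) *\<^sub>R real_vec (k *s x) \<in> convex_cone hull G"
    using assms(3) by (intro convex_cone_hull_mul) (auto simp: C)
  ultimately show ?thesis by (simp add: C)
qed

text \<open>Every nonzero element of \<open>C\<close> has infinitely many multiples in \<open>C\<close>, so some positive multiple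
  lies in \<open>T\<close>, hence in any cone containing \<open>T\<close>; dividing by the multiplier stays in that cone.\<close>

lemma minimal_integer_cone_cofinite:
  assumes C: "integer_cone C" and "T \<subseteq> C" "finite (C - T)"
  shows "minimal_integer_cone T C"
  unfolding minimal_integer_cone_def
proof (intro conjI allI impI subsetI)
  fix D x assume D: "integer_cone D \<and> T \<subseteq> D" and x: "x \<in> C"
  show "x \<in> D"
  proof (cases "x = 0")
    case True
    then show ?thesis using D integer_cone_submonoid submonoid_zero by blast
  next
    case False
    then obtain i where i: "x $ i \<noteq> 0" by (auto simp: vec_eq_iff)
    have "inj (\<lambda>k. k *s x)"
    proof (rule injI)
      fix k l assume "k *s x = l *s x"
      then have "k * x $ i = l * x $ i" by (metis vector_smult_component)
      then show "k = l" using i by simp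
    qed
    then have "infinite ((\<lambda>k. k *s x) ` {0<..})"
      using infinite_Ioi[of "0 :: nat"] by (metis finite_imageD inj_on_subset subset_UNIV)
    then have "\<not> (\<lambda>k. k *s x) ` {0<..} \<subseteq> C - T"
      using assms(3) finite_subset by blast
    moreover have "k *s x \<in> C" for k
      using multiples_subset[OF integer_cone_submonoid[OF C] x] by (auto simp: multiples_def)
    ultimately obtain k where "0 < k" "k *s x \<in> T" by auto
    then show ?thesis using integer_cone_saturated[of D k x] D by blast
  qed
qed (use assms in auto)

section \<open>Frobenius elements\<close>

lemma int_vec_inject: "int_vec x = int_vec y \<longleftrightarrow> x = y"
  by (simp add: int_vec_def vec_eq_iff)

text \<open>A Frobenius element with non-negative entries therefore witnesses that gaps exist.\<close>

lemma negative_basis_sum_neq_int_vec: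
  "- (\<Sum>e\<in>canonical_basis. int_vec e) \<noteq> int_vec (f :: nat ^ 'p)"
proof
  assume "- (\<Sum>e\<in>canonical_basis. int_vec e) = int_vec f"
  then have "- (\<Sum>e\<in>canonical_basis. int_vec e $ i) = int_vec f $ i" for i
    by (metis sum_component vector_uminus_component)
  moreover have "int_vec (axis i 1) $ i \<le> (\<Sum>e\<in>canonical_basis. int_vec e $ i)" for i :: 'p
    by (rule member_le_sum) (auto simp: canonical_basis_def int_vec_def)
  ultimately have "int_vec (axis i 1) $ i \<le> - (int_vec f $ i)" for i :: 'p
    by (metis minus_minus)
  then show False by (simp add: int_vec_def)
qed

lemma total_order_has_greatest:
  assumes "finite H" "H \<noteq> {}" "reflp le" "transp le" "totalp le"
  shows "\<exists>h\<in>H. \<forall>x\<in>H. le x h"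
  using assms(1,2)
proof (induction H rule: finite_ne_induct)
  case (singleton x)
  then show ?case using assms(3) by (auto dest: reflpD)
next
  case (insert x H)
  then obtain h where h: "h \<in> H" "\<forall>y\<in>H. le y h" by blast
  consider "le x h" | "le h x"
    using assms(3,5) by (metis reflpD totalpD)
  then show ?case
  proof cases
    case 1
    then show ?thesis using h by auto
  next
    case 2
    have "le x x" using assms(3) by (rule reflpD)
    moreover have "le y x" if "y \<in> H" for y
      using h(2) 2 that transpD[OF assms(4)] by blast
    ultimately show ?thesis by auto
  qed
qed

lemma Fb_eq_int_vec_iff:
  assumes le: "monomial_order le" and fin: "finite (gaps C S)"
  shows "Fb C le S = int_vec f \<longleftrightarrow> f \<in> gaps C S \<and> (\<forall>x\<in>gaps C S. le x f)"
proof (cases "gaps C S = {}")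
  case True
  then show ?thesis using negative_basis_sum_neq_int_vec by (simp add: Fb_def)
next
  case False
  have ord: "reflp le" "transp le" "antisymp le" "totalp le"
    using le by (auto simp: monomial_order_def)
  obtain h where h: "h \<in> gaps C S" "\<forall>x\<in>gaps C S. le x h"
    using total_order_has_greatest[OF fin False ord(1,2,4)] by blast
  then have unique: "g = h" if "g \<in> gaps C S" "\<forall>x\<in>gaps C S. le x g" for g
    using that ord(3) by (metis antisympD)
  have "(THE h. h \<in> gaps C S \<and> (\<forall>x\<in>gaps C S. le x h)) = h"
    by (rule the_equality) (use h unique in blast)+
  then have "Fb C le S = int_vec h"
    using False by (simp add: Fb_def)
  then have "Fb C le S = int_vec f \<longleftrightarrow> f = h"
    using int_vec_inject by metis
  then show ?thesis
    using h unique by blast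
qed

section \<open>The family of semigroups with a given Frobenius element\<close>

locale cone_with_order =
  fixes C :: "(nat ^ 'p) set"
    and le :: "nat ^ 'p \<Rightarrow> nat ^ 'p \<Rightarrow> bool"
    and f :: "nat ^ 'p"
  assumes cone: "integer_cone C"
    and infinite_cone: "infinite C"
    and finitely_generated_cone: "finitely_generated C"
    and order: "monomial_order le"
    and finite_below: "finite {x \<in> C. le x f}"
    and f_in_C: "f \<in> C"
begin

lemma submonoid_C: "submonoid C"
  by (rule integer_cone_submonoid[OF cone])

lemma le_refl: "le x x"
  using order by (auto simp: monomial_order_def dest: reflpD)

lemma le_trans: "le x y \<Longrightarrow> le y z \<Longrightarrow> le x z"
  using order by (auto simp: monomial_order_def dest: transpD)

lemma le_antisym: "le x y \<Longrightarrow> le y x \<Longrightarrow> x = y"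
  using order by (auto simp: monomial_order_def dest: antisympD)

lemma not_le_iff: "\<not> le x y \<longleftrightarrow> strict le y x"
proof -
  have "le x y \<or> le y x"
    using order by (metis monomial_order_def reflpD totalpD)
  then show ?thesis using le_antisym le_refl by (auto simp: strict_def)
qed

lemma le_add: "le x (x + y)"
proof -
  have "le (0 + x) (y + x)"
    using order unfolding monomial_order_def by blast
  then show ?thesis by (simp add: add.commute)
qed

lemma strict_le_trans: "strict le x y \<Longrightarrow> le y z \<Longrightarrow> strict le x z"
  using le_trans le_antisym unfolding strict_def by blast

lemma le_strict_trans: "le x y \<Longrightarrow> strict le y z \<Longrightarrow> strict le x z"
  using le_trans le_antisym unfolding strict_def by blast

lemma add_strict_mono: "strict le x y \<Longrightarrow> strict le (x + z) (y + z)"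
  using order by (simp add: monomial_order_def strict_def)

lemma add_le_mono: "le x y \<Longrightarrow> le (x + z) (y + z)"
  using order by (simp add: monomial_order_def)

lemma int_strict_int_vec_iff: "int_strict le (int_vec x) (int_vec y) \<longleftrightarrow> strict le x y"
proof
  assume "int_strict le (int_vec x) (int_vec y)"
  then obtain a b where ab: "int_vec b - int_vec a = int_vec y - int_vec x" "strict le a b"
    by (auto simp: int_strict_def)
  have "x + b = y + a"
    unfolding vec_eq_iff
  proof
    fix i
    have "int (b $ i) - int (a $ i) = int (y $ i) - int (x $ i)"
      using arg_cong[OF ab(1), of "\<lambda>v. v $ i"] by (simp add: int_vec_def)
    then show "(x + b) $ i = (y + a) $ i" by simp
  qed
  moreover have "strict le (x + a) (x + b)"
    using add_strict_mono[OF ab(2), of x] by (simp add: add.commute)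
  ultimately show "strict le x y"
    using add_le_mono[of y x a] not_le_iff by metis
qed (auto simp: int_strict_def)

lemma Delta_subset: "Delta C le f \<subseteq> C"
  using submonoid_zero[OF submonoid_C] by (auto simp: Delta_def)

lemma add_in_Delta:
  assumes "x \<in> C" "y \<in> C" "strict le f x"
  shows "x + y \<in> Delta C le f"
  using assms submonoid_add[OF submonoid_C] strict_le_trans le_add by (simp add: Delta_def)

lemma C_semigroup_if_Delta_subset:
  assumes "submonoid T" "T \<subseteq> C" "Delta C le f \<subseteq> T"
  shows "C_semigroup C T"
proof -
  have "C - T \<subseteq> {x \<in> C. le x f}"
    using assms(3) not_le_iff by (auto simp: Delta_def)
  then have fin: "finite (C - T)"
    using finite_below finite_subset by blast
  then have "infinite T"
    using infinite_cone finite_Diff2 by blast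
  then show ?thesis
    using assms(1,2) fin cofinite_submonoid_finitely_generated[OF finitely_generated_cone]
      minimal_integer_cone_cofinite[OF cone]
    by (simp add: C_semigroup_def gaps_def)
qed

text \<open>Containing \<open>\<Delta>(f)\<close> and avoiding \<open>f\<close> makes \<open>f\<close> the largest gap, and it already forces the
  \<open>\<C>\<close>-semigroup conditions. In the condition on pairs, \<open>s\<close> lies below \<open>f\<close> as soon as \<open>s + e\<close> does.\<close>

lemma A_family_iff:
  "T \<in> A_family C le f \<longleftrightarrow>
     submonoid T \<and> T \<subseteq> C \<and> Delta C le f \<subseteq> T \<and> f \<notin> T \<and>
     (\<forall>s\<in>T. \<forall>e\<in>canonical_basis. s + e \<in> T \<longrightarrow> \<not> strict le (s + e) f)"
    (is "_ \<longleftrightarrow> ?R T")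
proof -
  have Fb_iff: "Fb C le T = int_vec f \<longleftrightarrow> Delta C le f \<subseteq> T \<and> f \<notin> T" if "C_semigroup C T"
  proof -
    have T: "0 \<in> T" "finite (gaps C T)"
      using that submonoid_zero by (auto simp: C_semigroup_def)
    have "(\<forall>x\<in>gaps C T. le x f) \<longleftrightarrow> Delta C le f \<subseteq> T"
      using T(1) not_le_iff by (auto simp: gaps_def Delta_def)
    then show ?thesis
      using Fb_eq_int_vec_iff[OF order T(2), of f] f_in_C by (auto simp: gaps_def)
  qed
  have pairs_iff: "(\<forall>s\<in>T. \<forall>e\<in>canonical_basis. \<not> {s, s + e} \<subseteq> small_elements C le T) \<longleftrightarrow>
      (\<forall>s\<in>T. \<forall>e\<in>canonical_basis. s + e \<in> T \<longrightarrow> \<not> strict le (s + e) f)"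
    if "Fb C le T = int_vec f"
  proof (intro ball_cong refl)
    fix s e assume "s \<in> T"
    then show "\<not> {s, s + e} \<subseteq> small_elements C le T \<longleftrightarrow> (s + e \<in> T \<longrightarrow> \<not> strict le (s + e) f)"
      using that int_strict_int_vec_iff le_strict_trans[OF le_add]
      by (auto simp: small_elements_def)
  qed
  show ?thesis
  proof
    assume "T \<in> A_family C le f"
    then have T: "C_semigroup C T" "Fb C le T = int_vec f"
      and pairs: "\<forall>s\<in>T. \<forall>e\<in>canonical_basis. \<not> {s, s + e} \<subseteq> small_elements C le T"
      unfolding A_family_def A_semigroup_def by blast+
    have "submonoid T" "T \<subseteq> C" using T(1) by (simp_all add: C_semigroup_def)
    moreover have "Delta C le f \<subseteq> T" "f \<notin> T" using T(2) Fb_iff[OF T(1)] by simp_all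
    ultimately show "?R T"
      using iffD1[OF pairs_iff[OF T(2)] pairs] by (intro conjI)
  next
    assume R: "?R T"
    then have T: "C_semigroup C T" using C_semigroup_if_Delta_subset by blast
    have Fb: "Fb C le T = int_vec f" using R Fb_iff[OF T] by simp
    have "\<forall>s\<in>T. \<forall>e\<in>canonical_basis. \<not> {s, s + e} \<subseteq> small_elements C le T"
      by (rule iffD2[OF pairs_iff[OF Fb]]) (use R in simp)
    then have "A_semigroup C le T"
      unfolding A_semigroup_def using T by (intro conjI)
    then show "T \<in> A_family C le f"
      using Fb by (simp add: A_family_def)
  qed
qed

lemma A_family_submonoid:
  assumes "S \<in> A_family C le f" "submonoid T" "Delta C le f \<subseteq> T" "T \<subseteq> S"
  shows "T \<in> A_family C le f"
  using assms unfolding A_family_iff by blast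

lemma A_closure_eq_hull:
  assumes S: "S \<in> A_family C le f" and "X \<subseteq> S"
  shows "A_closure C le f X = submonoid hull (X \<union> Delta C le f)"
proof (rule antisym)
  have "submonoid hull (X \<union> Delta C le f) \<subseteq> S"
    using assms by (intro hull_minimal) (auto simp: A_family_iff)
  moreover have "X \<union> Delta C le f \<subseteq> submonoid hull (X \<union> Delta C le f)"
    by (rule hull_subset)
  ultimately show "A_closure C le f X \<subseteq> submonoid hull (X \<union> Delta C le f)"
    using A_family_submonoid[OF S submonoid_hull] unfolding A_closure_def by blast
  show "submonoid hull (X \<union> Delta C le f) \<subseteq> A_closure C le f X"
    unfolding A_closure_def
    by (intro Inter_greatest hull_minimal) (auto simp: A_family_iff)
qed

lemma A_closure_eq_iff:
  assumes S: "S \<in> A_family C le f" and "X \<subseteq> S"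
  shows "A_closure C le f X = S \<longleftrightarrow> irreducibles S - Delta C le f \<subseteq> X"
proof -
  have "submonoid S" "X \<union> Delta C le f \<subseteq> S"
    using assms by (auto simp: A_family_iff)
  then have "A_closure C le f X = S \<longleftrightarrow> irreducibles S \<subseteq> X \<union> Delta C le f"
    unfolding A_closure_eq_hull[OF assms] by (rule submonoid_hull_eq_iff)
  then show ?thesis by blast
qed

lemma minimal_A_generators_iff:
  assumes S: "S \<in> A_family C le f"
  shows "minimal_A_generators C le f S X \<longleftrightarrow> X = irreducibles S - Delta C le f"
    (is "_ \<longleftrightarrow> X = ?I")
proof
  have I: "?I \<subseteq> S" by (auto simp: irreducibles_def)
  {
    assume X: "minimal_A_generators C le f S X"
    then have cl: "A_closure C le f X = S"
      by (simp add: minimal_A_generators_def A_generators_def)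
    moreover have "X \<subseteq> A_closure C le f X" by (auto simp: A_closure_def)
    ultimately have "?I \<subseteq> X"
      using A_closure_eq_iff[OF S] by blast
    moreover have "A_closure C le f ?I = S"
      using A_closure_eq_iff[OF S I] by blast
    ultimately show "X = ?I"
      using X unfolding minimal_A_generators_def by blast
  next
    assume X: "X = ?I"
    have "A_closure C le f X = S"
      using A_closure_eq_iff[OF S I] X by blast
    moreover have "A_set C le f X"
      using S I X unfolding A_set_def by blast
    moreover have "A_closure C le f Y \<noteq> S" if "Y \<subset> X" for Y
      using A_closure_eq_iff[OF S, of Y] that X I by blast
    ultimately show "minimal_A_generators C le f S X"
      by (simp add: minimal_A_generators_def A_generators_def)
  }
qed

lemma A_rank_eq:
  assumes "S \<in> A_family C le f"
  shows "A_rank C le f S = card (irreducibles S - Delta C le f)"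
  using minimal_A_generators_iff[OF assms] by (simp add: A_rank_def)

section \<open>Semigroups of rank one\<close>

lemma submonoid_multiples_Un_Delta:
  assumes "m \<in> C"
  shows "submonoid (multiples m \<union> Delta C le f)"
  unfolding submonoid_def
proof (intro conjI ballI)
  show "0 \<in> multiples m \<union> Delta C le f" by (simp add: Delta_def)
  fix x y assume xy: "x \<in> multiples m \<union> Delta C le f" "y \<in> multiples m \<union> Delta C le f"
  then have C: "x \<in> C" "y \<in> C"
    using multiples_subset[OF submonoid_C assms] Delta_subset by blast+
  consider "x \<in> multiples m" "y \<in> multiples m" | "x = 0" | "y = 0"
    | "strict le f x" | "strict le f y"
    using xy by (auto simp: Delta_def)
  then show "x + y \<in> multiples m \<union> Delta C le f"
  proof cases
    case 1
    then show ?thesis using submonoid_add[OF submonoid_multiples] by blast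
  next
    case 4
    then show ?thesis using add_in_Delta C by blast
  next
    case 5
    then show ?thesis using add_in_Delta[of y x] C by (simp add: add.commute)
  qed (use xy in auto)
qed

lemma submonoid_hull_insert_Delta:
  assumes "m \<in> C"
  shows "submonoid hull ({m} \<union> Delta C le f) = multiples m \<union> Delta C le f"
proof (rule hull_unique)
  show "{m} \<union> Delta C le f \<subseteq> multiples m \<union> Delta C le f"
    using self_in_multiples by blast
  show "multiples m \<union> Delta C le f \<subseteq> T" if "{m} \<union> Delta C le f \<subseteq> T" "submonoid T" for T
    using that multiples_subset by blast
qed (rule submonoid_multiples_Un_Delta[OF assms])

lemma rank_one_imp_multiples_Un_Delta:
  assumes S: "S \<in> A_family C le f" and rank: "A_rank C le f S = 1"
  shows "\<exists>m\<in>C. m \<notin> canonical_basis \<and> m \<noteq> 0 \<and>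
    S = multiples m \<union> Delta C le f \<and> strict le m f \<and> f \<notin> multiples m"
proof -
  obtain m where m: "irreducibles S - Delta C le f = {m}"
    using rank A_rank_eq[OF S] card_1_singletonE by metis
  have props: "submonoid S" "S \<subseteq> C" "f \<notin> S"
    "\<And>s e. s \<in> S \<Longrightarrow> e \<in> canonical_basis \<Longrightarrow> s + e \<in> S \<Longrightarrow> \<not> strict le (s + e) f"
    using S unfolding A_family_iff by blast+
  have mS: "m \<in> S" "m \<noteq> 0" "m \<notin> Delta C le f"
    using m by (auto simp: irreducibles_def)
  then have mC: "m \<in> C" using props(2) by blast
  have S_eq: "S = multiples m \<union> Delta C le f"
    using A_closure_eq_iff[OF S, of "{m}"] A_closure_eq_hull[OF S, of "{m}"]
      submonoid_hull_insert_Delta[OF mC] m mS(1) by simp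
  have "le m f"
    using mS(3) mC not_le_iff by (auto simp: Delta_def)
  then have "strict le m f"
    using mS(1) props(3) by (auto simp: strict_def)
  moreover have "m \<notin> canonical_basis"
    using props(4)[of 0 m] submonoid_zero[OF props(1)] mS(1) \<open>strict le m f\<close> by auto
  ultimately show ?thesis
    using mC mS(2) S_eq props(3) by blast
qed

lemma multiples_Un_Delta_rank_one:
  assumes m: "m \<in> C" "m \<notin> canonical_basis" "m \<noteq> 0" "strict le m f" "f \<notin> multiples m"
    and S: "S = multiples m \<union> Delta C le f"
  shows "S \<in> A_family C le f \<and> A_rank C le f S = 1"
proof -
  have below: "x \<in> multiples m" if "x \<in> S" "le x f" for x
  proof -
    have "0 \<in> multiples m" using submonoid_zero[OF submonoid_multiples] .
    then show ?thesis
      using that not_le_iff[of x f] by (auto simp: S Delta_def)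
  qed
  have monoid: "submonoid S"
    unfolding S by (rule submonoid_multiples_Un_Delta[OF m(1)])
  have subset: "S \<subseteq> C"
    unfolding S using multiples_subset[OF submonoid_C m(1)] Delta_subset by blast
  have "f \<notin> S" using below le_refl m(5) by blast
  moreover have "\<not> strict le (s + e) f"
    if "s \<in> S" "e \<in> canonical_basis" "s + e \<in> S" for s e
  proof
    assume "strict le (s + e) f"
    then have "le (s + e) f" "le s f"
      using le_trans[OF le_add] by (auto simp: strict_def)
    then have "e \<in> multiples m"
      using below that sum_in_multiples_cancel by blast
    then show False
      using basis_vector_in_multiples that(2) m(2) by blast
  qed
  ultimately have family: "S \<in> A_family C le f"
    using monoid subset unfolding A_family_iff S by blast
  have mS: "m \<in> S" using self_in_multiples by (auto simp: S)
  have m_notin: "m \<notin> Delta C le f"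
    using m(3,4) not_le_iff by (auto simp: Delta_def strict_def)
  have "A_closure C le f {m} = S"
    using A_closure_eq_hull[OF family, of "{m}"] mS submonoid_hull_insert_Delta[OF m(1)] S by simp
  then have "irreducibles S - Delta C le f \<subseteq> {m}"
    using A_closure_eq_iff[OF family, of "{m}"] mS by blast
  \<comment> \<open>Otherwise the empty set would generate \<open>S\<close>; but it generates only \<open>\<Delta>(f)\<close>, which misses \<open>m\<close>.\<close>
  moreover have "irreducibles S - Delta C le f \<noteq> {}"
  proof
    assume "irreducibles S - Delta C le f = {}"
    then have "submonoid hull (Delta C le f) = S"
      using A_closure_eq_iff[OF family, of "{}"] A_closure_eq_hull[OF family, of "{}"] by simp
    moreover have "submonoid hull (Delta C le f) = Delta C le f"
    proof (rule hull_same)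
      have "multiples 0 \<union> Delta C le f = Delta C le f"
        by (auto simp: multiples_def Delta_def vec_eq_iff)
      then show "submonoid (Delta C le f)"
        using submonoid_multiples_Un_Delta[OF submonoid_zero[OF submonoid_C]] by simp
    qed
    ultimately show False using mS m_notin by simp
  qed
  ultimately have "irreducibles S - Delta C le f = {m}" by blast
  then show ?thesis using family A_rank_eq[OF family] by simp
qed

end

theorem theorem11:
  fixes C S :: "(nat ^ 'p) set"
    and le :: "nat ^ 'p \<Rightarrow> nat ^ 'p \<Rightarrow> bool"
    and f :: "nat ^ 'p"
  assumes "integer_cone C"
    and "CARD('p) \<le> card (extremal_rays C)"
    and "monomial_order le"
    and "\<And>k. k \<in> C \<Longrightarrow> finite {x \<in> C. le x k}"
    and "C_semigroup C S"
    and "f \<in> C"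
  shows "S \<in> A_family C le f \<and> A_rank C le f S = 1 \<longleftrightarrow>
    (\<exists>m\<in>C. m \<notin> canonical_basis \<and> m \<noteq> 0 \<and>
       S = multiples m \<union> Delta C le f \<and> strict le m f \<and> f \<notin> multiples m)"
proof -
  have S: "infinite S" "finitely_generated S" "S \<subseteq> C" "finite (C - S)"
    using assms(5) by (auto simp: C_semigroup_def gaps_def)
  interpret cone_with_order C le f
  proof
    show "infinite C" using S finite_subset by blast
    \<comment> \<open>Finite generation of the cone comes from the semigroup: its generators and gaps generate \<open>C\<close>.\<close>
    show "finitely_generated C"
      using finitely_generated_cofinite_extension integer_cone_submonoid[OF assms(1)] S by blast
  qed (use assms in auto)
  show ?thesis
    by (intro iffI; elim conjE bexE)
      (rule rank_one_imp_multiples_Un_Delta multiples_Un_Delta_rank_one; assumption)+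
qed

end
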